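(* Let $H$ be a complex Hilbert space, $A\in B(H)$ a normal operator with spectral measure $E_A$, and $U\subset\mathbb{C}$ an open set with $\sigma(A)\subseteq U$. Let $p_1,\dots,p_K$ be holomorphic functions on $U$ with $\sup_{\lambda\in\sigma(A)}|p_k(\lambda)|\le 1$ and $p_k(1)=1$ for each $k$. Let $f:=p_K\circ\cdots\circ p_1$, and let $f^m$ be the $m$-fold composition of $f$ with itself (all these compositions being defined on a neighbourhood of $\sigma(A)$). Let $\Sigma_{\mathrm{fix}}:=\{\lambda\in\sigma(A):|\lambda|=1,\ p_k(\lambda)=\lambda\ \text{for all }k\}$. Suppose that (1) $f^m(\lambda)\to 1$ for all $\lambda\in\Sigma_{\mathrm{fix}}$; (2) $f^m(\lambda)\to 0$ for all $\lambda\in\sigma(A)\setminus\Sigma_{\mathrm{fix}}$; (3) $\sup_m\|f^m\|_\infty\le 1$. Then $A^{(\omega)}:=\lim_{m\to\infty}f^m(A)$ exists in the strong operator topology and equals $E_A(\Sigma_{\mathrm{fix}})$, which is an orthogonal projection commuting with $A$.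
   Context: $\|g\|_\infty:=\sup_{\lambda\in\sigma(A)}|g(\lambda)|$. For a bounded Borel function $g$ on $\sigma(A)$, $g(A)=\int g\,dE_A$ is the Borel functional calculus of the normal operator $A$. *)

theory Defs
  imports "HOL-Complex_Analysis.Complex_Analysis"
begin

text \<open>
  Complex Hilbert spaces: a Banach space whose real structure is the restriction of a complex one
  and whose norm comes from a Hermitian inner product, linear in its second argument.
  Positive definiteness is a consequence of the last axiom, since norms are nonnegative and
  vanish only at 0.
\<close>

class complex_hilbert_space = banach +
  fixes scaleC :: "complex \<Rightarrow> 'a \<Rightarrow> 'a"  (infixr "*\<^sub>C" 75)
    and cinner :: "'a \<Rightarrow> 'a \<Rightarrow> complex"
  assumes scaleC_add_right: "c *\<^sub>C (x + y) = c *\<^sub>C x + c *\<^sub>C y"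
    and scaleC_add_left: "(c + d) *\<^sub>C x = c *\<^sub>C x + d *\<^sub>C x"
    and scaleC_scaleC: "c *\<^sub>C d *\<^sub>C x = (c * d) *\<^sub>C x"
    and scaleR_scaleC: "scaleR r x = complex_of_real r *\<^sub>C x"
    and cinner_commute: "cinner x y = cnj (cinner y x)"
    and cinner_add_right: "cinner x (y + z) = cinner x y + cinner x z"
    and cinner_scaleC_right: "cinner x (c *\<^sub>C y) = c * cinner x y"
    and norm_eq_sqrt_cinner: "norm x = sqrt (Re (cinner x x))"

text \<open>
  The type of bounded \<^emph>\<open>real\<close>-linear maps comes from the library; B(H) is the subset of those
  that are complex-linear.
\<close>

definition clinear_op :: "('a::complex_hilbert_space \<Rightarrow>\<^sub>L 'a) \<Rightarrow> bool" where
  "clinear_op T \<longleftrightarrow> (\<forall>c x. blinfun_apply T (c *\<^sub>C x) = c *\<^sub>C blinfun_apply T x)"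

definition cadjoint :: "('a::complex_hilbert_space \<Rightarrow>\<^sub>L 'a) \<Rightarrow> ('a \<Rightarrow>\<^sub>L 'a)" where
  "cadjoint T = (THE S. \<forall>x y. cinner (blinfun_apply T x) y = cinner x (blinfun_apply S y))"

definition normal_op :: "('a::complex_hilbert_space \<Rightarrow>\<^sub>L 'a) \<Rightarrow> bool" where
  "normal_op T \<longleftrightarrow> clinear_op T \<and> T o\<^sub>L cadjoint T = cadjoint T o\<^sub>L T"

definition orthogonal_projection :: "('a::complex_hilbert_space \<Rightarrow>\<^sub>L 'a) \<Rightarrow> bool" where
  "orthogonal_projection P \<longleftrightarrow> clinear_op P \<and> P o\<^sub>L P = P \<and>
     (\<forall>x y. cinner (blinfun_apply P x) y = cinner x (blinfun_apply P y))"

definition spectrum :: "('a::complex_hilbert_space \<Rightarrow>\<^sub>L 'a) \<Rightarrow> complex set" where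
  "spectrum T = {c. \<not> (\<exists>S. clinear_op S \<and>
     (\<forall>x. blinfun_apply S (blinfun_apply T x - c *\<^sub>C x) = x) \<and>
     (\<forall>x. blinfun_apply T (blinfun_apply S x) - c *\<^sub>C blinfun_apply S x = x))}"

text \<open>
  Projection-valued measures on a measurable space \<open>M\<close> (only \<open>space M\<close> and \<open>sets M\<close> matter),
  countably additive in the strong operator topology.
\<close>

definition projection_valued_measure ::
    "'b measure \<Rightarrow> ('b set \<Rightarrow> ('a::complex_hilbert_space \<Rightarrow>\<^sub>L 'a)) \<Rightarrow> bool" where
  "projection_valued_measure M E \<longleftrightarrow>
     (\<forall>S\<in>sets M. orthogonal_projection (E S)) \<and>
     E {} = 0 \<and> E (space M) = id_blinfun \<and>
     (\<forall>S\<in>sets M. \<forall>T\<in>sets M. E (S \<inter> T) = E S o\<^sub>L E T) \<and>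
     (\<forall>F::nat \<Rightarrow> 'b set. range F \<subseteq> sets M \<longrightarrow> disjoint_family F \<longrightarrow>
        (\<forall>x. (\<lambda>n. blinfun_apply (E (F n)) x) sums blinfun_apply (E (\<Union>n. F n)) x))"

definition scalar_spectral_measure ::
    "'b measure \<Rightarrow> ('b set \<Rightarrow> ('a::complex_hilbert_space \<Rightarrow>\<^sub>L 'a)) \<Rightarrow> 'a \<Rightarrow> 'b measure" where
  "scalar_spectral_measure M E x =
     measure_of (space M) (sets M) (\<lambda>S. ennreal (Re (cinner x (blinfun_apply (E S) x))))"

text \<open>
  \<open>T = \<integral> g dE\<close> in the weak sense. The diagonal of the sesquilinear form determines \<open>T\<close> by
  polarization, so no complex measures are needed.
\<close>

definition has_spectral_integral ::
    "'b measure \<Rightarrow> ('b set \<Rightarrow> ('a::complex_hilbert_space \<Rightarrow>\<^sub>L 'a)) \<Rightarrow> ('b \<Rightarrow> complex) \<Rightarrow>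
     ('a \<Rightarrow>\<^sub>L 'a) \<Rightarrow> bool" where
  "has_spectral_integral M E g T \<longleftrightarrow> clinear_op T \<and>
     (\<forall>x. integrable (scalar_spectral_measure M E x) g \<and>
          cinner x (blinfun_apply T x) = integral\<^sup>L (scalar_spectral_measure M E x) g)"

definition spectral_integral ::
    "'b measure \<Rightarrow> ('b set \<Rightarrow> ('a::complex_hilbert_space \<Rightarrow>\<^sub>L 'a)) \<Rightarrow> ('b \<Rightarrow> complex) \<Rightarrow>
     ('a \<Rightarrow>\<^sub>L 'a)" where
  "spectral_integral M E g = (THE T. has_spectral_integral M E g T)"

abbreviation borel_spectrum :: "('a::complex_hilbert_space \<Rightarrow>\<^sub>L 'a) \<Rightarrow> complex measure" where
  "borel_spectrum A \<equiv> restrict_space borel (spectrum A)"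

definition is_spectral_measure ::
    "('a::complex_hilbert_space \<Rightarrow>\<^sub>L 'a) \<Rightarrow> (complex set \<Rightarrow> ('a \<Rightarrow>\<^sub>L 'a)) \<Rightarrow> bool" where
  "is_spectral_measure A E \<longleftrightarrow>
     projection_valued_measure (borel_spectrum A) E \<and>
     has_spectral_integral (borel_spectrum A) E (\<lambda>z. z) A"

definition borel_calculus ::
    "('a::complex_hilbert_space \<Rightarrow>\<^sub>L 'a) \<Rightarrow> (complex set \<Rightarrow> ('a \<Rightarrow>\<^sub>L 'a)) \<Rightarrow>
     (complex \<Rightarrow> complex) \<Rightarrow> ('a \<Rightarrow>\<^sub>L 'a)" where
  "borel_calculus A E g = spectral_integral (borel_spectrum A) E g"

text \<open>
  The supremum is taken in \<open>[0,\<infinity>]\<close>, so that it is meaningful for unbounded functions and for an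
  empty set (the spectrum is empty if the space is zero).
\<close>

definition sup_norm_on :: "complex set \<Rightarrow> (complex \<Rightarrow> complex) \<Rightarrow> ennreal" where
  "sup_norm_on S g = (SUP z\<in>S. ennreal (cmod (g z)))"

text \<open>\<open>comp_upto p j\<close> is the composition of \<open>p 1, \<dots>, p j\<close>, with \<open>p 1\<close> applied first.\<close>

primrec comp_upto :: "(nat \<Rightarrow> complex \<Rightarrow> complex) \<Rightarrow> nat \<Rightarrow> complex \<Rightarrow> complex" where
  "comp_upto p 0 = id"
| "comp_upto p (Suc j) = p (Suc j) \<circ> comp_upto p j"

text \<open>
  With each \<open>p k\<close> regarded as a function with domain \<open>U\<close>, the \<open>m\<close>-fold iterate of
  \<open>comp_upto p K\<close> is defined at every point of \<open>V\<close>: every value that is fed into some \<open>p k\<close>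
  lies in \<open>U\<close>.
\<close>

definition iterate_defined_on ::
    "complex set \<Rightarrow> (nat \<Rightarrow> complex \<Rightarrow> complex) \<Rightarrow> nat \<Rightarrow> nat \<Rightarrow> complex set \<Rightarrow> bool" where
  "iterate_defined_on U p K m V \<longleftrightarrow>
     (\<forall>z\<in>V. \<forall>i<m. \<forall>j<K. comp_upto p j ((comp_upto p K ^^ i) z) \<in> U)"

definition fixed_spectrum ::
    "('a::complex_hilbert_space \<Rightarrow>\<^sub>L 'a) \<Rightarrow> (nat \<Rightarrow> complex \<Rightarrow> complex) \<Rightarrow> nat \<Rightarrow> complex set" where
  "fixed_spectrum A p K = {z \<in> spectrum A. cmod z = 1 \<and> (\<forall>k\<in>{1..K}. p k z = z)}"

end

theory Submission
  imports Defs
begin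

text \<open>
  A bounded Borel function \<open>g\<close> is a pointwise limit of simple functions, whose spectral integrals
  satisfy \<open>\<parallel>T x\<parallel>\<^sup>2 = \<integral> |g|\<^sup>2 d\<mu>\<^sub>x\<close>; by dominated convergence they converge strongly, and the identity
  passes to the limit. Applied to \<open>f^m\<close> minus the indicator of the fixed spectrum, which is bounded
  and tends to 0 pointwise on the spectrum, dominated convergence gives strong convergence to the
  spectral projection.
\<close>

section \<open>Algebra of complex scalars and the inner product\<close>

lemma scaleC_one [simp]: "1 *\<^sub>C x = (x::'a::complex_hilbert_space)"
  using scaleR_scaleC[of 1 x] by simp

lemma scaleC_minus_one: "(-1) *\<^sub>C x = - (x::'a::complex_hilbert_space)"
  using scaleR_scaleC[of "-1" x] by simp

lemma scaleC_minus_right: "c *\<^sub>C (- x) = - (c *\<^sub>C (x::'a::complex_hilbert_space))"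
  by (simp add: scaleC_scaleC mult.commute flip: scaleC_minus_one)

lemma scaleC_diff_right: "c *\<^sub>C (x - y) = c *\<^sub>C x - c *\<^sub>C (y::'a::complex_hilbert_space)"
  using scaleC_add_right[of c x "- y"] by (simp add: scaleC_minus_right)

lemma scaleC_zero_right [simp]: "c *\<^sub>C (0::'a::complex_hilbert_space) = 0"
  using scaleC_diff_right[of c 0 0] by simp

lemma scaleC_zero_left: "0 *\<^sub>C (x::'a::complex_hilbert_space) = 0"
  using scaleR_scaleC[of 0 x] by simp

lemma scaleC_sum_right:
  "c *\<^sub>C (\<Sum>i\<in>I. g i) = (\<Sum>i\<in>I. c *\<^sub>C (g i :: 'a::complex_hilbert_space))"
  by (induction I rule: infinite_finite_induct) (auto simp: scaleC_add_right)

lemma cinner_minus_right: "cinner x (- y) = - cinner x (y::'a::complex_hilbert_space)"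
  using cinner_scaleC_right[of x "-1" y] by (simp add: scaleC_minus_one)

lemma cinner_diff_right: "cinner x (y - z) = cinner x y - cinner x (z::'a::complex_hilbert_space)"
  using cinner_add_right[of x y "- z"] by (simp add: cinner_minus_right)

lemma cinner_zero_right [simp]: "cinner x (0::'a::complex_hilbert_space) = 0"
  using cinner_diff_right[of x 0 0] by simp

lemma cinner_zero_left [simp]: "cinner 0 (x::'a::complex_hilbert_space) = 0"
  using cinner_commute[of 0 x] by simp

lemma cinner_add_left: "cinner (x + y) z = cinner x z + cinner y (z::'a::complex_hilbert_space)"
  by (simp add: cinner_commute[of _ z] cinner_add_right)

lemma cinner_diff_left: "cinner (x - y) z = cinner x z - cinner y (z::'a::complex_hilbert_space)"
  by (simp add: cinner_commute[of _ z] cinner_diff_right)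

lemma cinner_scaleC_left: "cinner (c *\<^sub>C x) y = cnj c * cinner x (y::'a::complex_hilbert_space)"
  by (simp add: cinner_commute[of _ y] cinner_scaleC_right)

lemma cinner_sum_right:
  "cinner x (\<Sum>i\<in>I. g i) = (\<Sum>i\<in>I. cinner x (g i :: 'a::complex_hilbert_space))"
  by (induction I rule: infinite_finite_induct) (auto simp: cinner_add_right)

lemma cinner_sum_left:
  "cinner (\<Sum>i\<in>I. g i) x = (\<Sum>i\<in>I. cinner (g i) (x :: 'a::complex_hilbert_space))"
  by (induction I rule: infinite_finite_induct) (auto simp: cinner_add_left)

lemma cinner_self: "cinner x x = complex_of_real ((norm (x::'a::complex_hilbert_space))\<^sup>2)"
proof (rule complex_eqI)
  \<comment> \<open>\<open>sqrt\<close> is odd on the reals, so a nonnegative root forces a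
    nonnegative radicand.\<close>
  have "0 \<le> Re (cinner x x)"
    by (metis norm_eq_sqrt_cinner norm_ge_zero real_sqrt_ge_0_iff)
  then show "Re (cinner x x) = Re (complex_of_real ((norm x)\<^sup>2))"
    by (simp add: norm_eq_sqrt_cinner)
  show "Im (cinner x x) = Im (complex_of_real ((norm x)\<^sup>2))"
    using arg_cong[OF cinner_commute[of x x], of Im] by simp
qed

lemma norm_scaleC: "norm (c *\<^sub>C x) = cmod c * norm (x::'a::complex_hilbert_space)"
proof -
  have "complex_of_real ((norm (c *\<^sub>C x))\<^sup>2) = cnj c * c * complex_of_real ((norm x)\<^sup>2)"
    by (simp only: cinner_self[symmetric] cinner_scaleC_left cinner_scaleC_right mult_ac)
  also have "\<dots> = complex_of_real ((cmod c * norm x)\<^sup>2)"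
    by (simp only: power_mult_distrib of_real_mult complex_norm_square mult_ac)
  finally have "(norm (c *\<^sub>C x))\<^sup>2 = (cmod c * norm x)\<^sup>2"
    by (simp only: of_real_eq_iff)
  then show ?thesis by simp
qed

lemma tendsto_scaleC:
  assumes "(g \<longlongrightarrow> l) F"
  shows "((\<lambda>n. c *\<^sub>C (g n :: 'a::complex_hilbert_space)) \<longlongrightarrow> c *\<^sub>C l) F"
proof -
  have "((\<lambda>n. cmod c * norm (g n - l)) \<longlongrightarrow> cmod c * 0) F"
    by (intro tendsto_mult tendsto_const tendsto_norm_zero LIM_zero assms)
  then have "((\<lambda>n. norm (c *\<^sub>C g n - c *\<^sub>C l)) \<longlongrightarrow> 0) F"
    by (simp add: scaleC_diff_right[symmetric] norm_scaleC)
  then show ?thesis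
    by (rule LIM_zero_cancel[OF tendsto_norm_zero_cancel])
qed

section \<open>Polarization and quadratic forms\<close>

lemma Re_cinner_polarization:
  "Re (cinner x y) = ((norm (x + y))\<^sup>2 - (norm x)\<^sup>2 - (norm (y::'a::complex_hilbert_space))\<^sup>2) / 2"
proof -
  have "complex_of_real ((norm (x + y))\<^sup>2) =
      of_real ((norm x)\<^sup>2) + of_real ((norm y)\<^sup>2) + cinner x y + cnj (cinner x y)"
    by (simp only: cinner_self[symmetric] cinner_add_left cinner_add_right
        cinner_commute[of y x]) simp
  from arg_cong[OF this, of Re] show ?thesis by simp
qed

text \<open>Polarization reduces the continuity of the inner product to that of the norm, so that the
  Cauchy--Schwarz inequality is not needed.\<close>

lemma tendsto_cinner_right:
  assumes "(g \<longlongrightarrow> l) F"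
  shows "((\<lambda>n. cinner x (g n :: 'a::complex_hilbert_space)) \<longlongrightarrow> cinner x l) F"
proof -
  have Re: "((\<lambda>n. Re (cinner x (h n))) \<longlongrightarrow> Re (cinner x k)) F" if "(h \<longlongrightarrow> k) F" for h k
    unfolding Re_cinner_polarization using that by (intro tendsto_intros) auto
  have Im: "Im (cinner x y) = - Re (cinner x (\<i> *\<^sub>C y))" for y
    by (simp add: cinner_scaleC_right)
  have "((\<lambda>n. Im (cinner x (g n))) \<longlongrightarrow> Im (cinner x l)) F"
    unfolding Im by (intro tendsto_minus Re tendsto_scaleC assms)
  with Re[OF assms] show ?thesis
    by (simp add: tendsto_complex_iff)
qed

text \<open>Complex scalars are essential: a rotation of the real plane by a right angle has zero
  quadratic form. Expanding the form at \<open>u + v\<close> shows that the sesquilinear form is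
  antisymmetric; replacing \<open>v\<close> by \<open>\<i> *\<^sub>C v\<close> shows that it is also
  symmetric, hence it vanishes.\<close>

lemma quadratic_form_zero_imp_zero:
  fixes D :: "'a::complex_hilbert_space \<Rightarrow>\<^sub>L 'a"
  assumes D: "clinear_op D" and zero: "\<And>x. cinner x (blinfun_apply D x) = 0"
  shows "D = 0"
proof (rule blinfun_eqI)
  fix y
  have sym: "cinner u (blinfun_apply D v) + cinner v (blinfun_apply D u) = 0" for u v
    using zero[of "u + v"] zero[of u] zero[of v]
    by (simp add: blinfun.add_right cinner_add_left cinner_add_right add.commute)
  have "\<i> * cinner u (blinfun_apply D v) - \<i> * cinner v (blinfun_apply D u) = 0" for u v
    using sym[of u "\<i> *\<^sub>C v"] D
    by (simp add: clinear_op_def cinner_scaleC_left cinner_scaleC_right)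
  then have "cinner u (blinfun_apply D v) = cinner v (blinfun_apply D u)" for u v
    by (simp add: right_diff_distrib[symmetric])
  \<comment> \<open>With \<open>u = D y\<close> and \<open>v = y\<close> the vanishing form is the
    squared norm of \<open>D y\<close>.\<close>
  from this[of "blinfun_apply D y" y] sym[of "blinfun_apply D y" y]
  have "cinner (blinfun_apply D y) (blinfun_apply D y) = 0" by simp
  then show "blinfun_apply D y = blinfun_apply 0 y"
    by (simp add: cinner_self)
qed

section \<open>Uniqueness of spectral integrals\<close>

lemma clinear_op_diff: "clinear_op S \<Longrightarrow> clinear_op T \<Longrightarrow> clinear_op (S - T)"
  by (simp add: clinear_op_def blinfun.diff_left scaleC_diff_right)

lemma clinear_op_add: "clinear_op S \<Longrightarrow> clinear_op T \<Longrightarrow> clinear_op (S + T)"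
  by (simp add: clinear_op_def blinfun.add_left scaleC_add_right)

lemma clinear_op_compose: "clinear_op S \<Longrightarrow> clinear_op T \<Longrightarrow> clinear_op (S o\<^sub>L T)"
  by (simp add: clinear_op_def)

text \<open>The integrals prescribe the quadratic form of the operator, and this determines it.
  Hence the definite description in \<open>spectral_integral\<close> picks out any operator that is
  shown to be the integral.\<close>

lemma has_spectral_integral_unique:
  assumes "has_spectral_integral M E g S" and "has_spectral_integral M E g T"
  shows "S = T"
proof -
  have "S - T = 0"
    using assms by (intro quadratic_form_zero_imp_zero clinear_op_diff)
      (auto simp: has_spectral_integral_def blinfun.diff_left cinner_diff_right)
  then show ?thesis by simp
qed

lemma spectral_integral_eq: "has_spectral_integral M E g T \<Longrightarrow> spectral_integral M E g = T"
  unfolding spectral_integral_def by (rule the_equality) (auto intro: has_spectral_integral_unique)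

lemma has_spectral_integral_diff:
  assumes "has_spectral_integral M E g S" and "has_spectral_integral M E h T"
  shows "has_spectral_integral M E (\<lambda>z. g z - h z) (S - T)"
  using assms unfolding has_spectral_integral_def
  by (auto simp: clinear_op_diff blinfun.diff_left cinner_diff_right)

section \<open>Scalar measures of a projection-valued measure\<close>

locale pvm =
  fixes M :: "'b measure" and E :: "'b set \<Rightarrow> ('a::complex_hilbert_space \<Rightarrow>\<^sub>L 'a)"
  assumes pvm: "projection_valued_measure M E"
begin

abbreviation \<mu> :: "'a \<Rightarrow> 'b measure" where "\<mu> \<equiv> scalar_spectral_measure M E"

lemma orthogonal_projection_E: "S \<in> sets M \<Longrightarrow> orthogonal_projection (E S)"
  using pvm by (simp add: projection_valued_measure_def)

lemma clinear_E: "S \<in> sets M \<Longrightarrow> clinear_op (E S)"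
  using orthogonal_projection_E by (auto simp: orthogonal_projection_def)

lemma E_scaleC: "S \<in> sets M \<Longrightarrow> E S (c *\<^sub>C x) = c *\<^sub>C E S x"
  using clinear_E by (auto simp: clinear_op_def)

lemma cinner_E_left: "S \<in> sets M \<Longrightarrow> cinner (E S x) y = cinner x (E S y)"
  using orthogonal_projection_E by (auto simp: orthogonal_projection_def)

lemma E_E: "S \<in> sets M \<Longrightarrow> T \<in> sets M \<Longrightarrow> E S (E T x) = E (S \<inter> T) x"
  using pvm by (simp add: projection_valued_measure_def)

lemma E_empty: "E {} = 0" and E_space: "E (space M) = id_blinfun"
  using pvm by (simp_all add: projection_valued_measure_def)

lemma E_sums:
  "range F \<subseteq> sets M \<Longrightarrow> disjoint_family F \<Longrightarrow> (\<lambda>n. E (F n) x) sums E (\<Union>n. F n) x"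
  using pvm by (simp add: projection_valued_measure_def)

lemma cinner_E_E: "S \<in> sets M \<Longrightarrow> T \<in> sets M \<Longrightarrow> cinner (E S x) (E T x) = cinner x (E (S \<inter> T) x)"
  by (simp add: cinner_E_left E_E)

lemma cinner_E: "S \<in> sets M \<Longrightarrow> cinner x (E S x) = complex_of_real ((norm (E S x))\<^sup>2)"
  using cinner_E_E[of S S x] by (simp add: cinner_self)

lemma sets_mu [simp, measurable_cong]: "sets (\<mu> x) = sets M"
  by (simp add: scalar_spectral_measure_def sets.sigma_sets_eq)

lemma space_mu [simp]: "space (\<mu> x) = space M"
  by (simp add: scalar_spectral_measure_def)

text \<open>\<open>measure_of\<close> reproduces a set function only if it is a measure, so
  countable additivity must be checked. It follows from strong additivity of \<open>E\<close> by
  continuity of the inner product. The values are squared norms because each \<open>E S\<close> is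
  an orthogonal projection.\<close>

lemma emeasure_mu:
  assumes "S \<in> sets M"
  shows "emeasure (\<mu> x) S = ennreal ((norm (E S x))\<^sup>2)"
proof -
  let ?m = "\<lambda>S. ennreal (Re (cinner x (E S x)))"
  have "countably_additive (sets M) ?m"
  proof (rule countably_additiveI)
    fix F :: "nat \<Rightarrow> 'b set"
    assume F: "range F \<subseteq> sets M" "disjoint_family F" "(\<Union>i. F i) \<in> sets M"
    have "(\<lambda>n. Re (cinner x (\<Sum>i<n. E (F i) x))) \<longlonglongrightarrow> Re (cinner x (E (\<Union>i. F i) x))"
      using E_sums[OF F(1,2)] by (intro tendsto_Re tendsto_cinner_right) (simp add: sums_def)
    then have "(\<lambda>i. Re (cinner x (E (F i) x))) sums Re (cinner x (E (\<Union>i. F i) x))"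
      by (simp add: sums_def cinner_sum_right)
    moreover have "0 \<le> Re (cinner x (E (F i) x))" for i
      using F by (subst cinner_E) auto
    ultimately show "(\<Sum>i. ?m (F i)) = ?m (\<Union>i. F i)"
      by (simp add: suminf_ennreal2 sums_summable sums_unique[symmetric])
  qed
  then have "emeasure (\<mu> x) S = ?m S"
    unfolding scalar_spectral_measure_def using assms
    by (intro emeasure_measure_of_sigma) (auto simp: positive_def E_empty sets.sigma_algebra_axioms)
  then show ?thesis
    using assms by (simp add: cinner_E)
qed

lemma finite_measure_mu: "finite_measure (\<mu> x)"
  by (rule finite_measureI) (simp add: emeasure_mu)

lemma measure_mu: "S \<in> sets M \<Longrightarrow> measure (\<mu> x) S = (norm (E S x))\<^sup>2"
  by (simp add: measure_def emeasure_mu)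

lemma integrable_mu_bounded:
  fixes g :: "'b \<Rightarrow> 'c::{banach,second_countable_topology}"
  assumes "g \<in> borel_measurable M" and "\<And>z. z \<in> space M \<Longrightarrow> norm (g z) \<le> B"
  shows "integrable (\<mu> x) g"
  by (rule finite_measure.integrable_const_bound[OF finite_measure_mu, where B = B])
    (use assms in \<open>auto\<close>)

text \<open>Dominated convergence with a constant majorant, which is integrable because
  \<open>\<mu> x\<close> is finite. The constant may be negative if the space is empty, whence
  \<open>norm B\<close> in the proof.\<close>

lemma tendsto_integral_mu_bounded:
  fixes g :: "'b \<Rightarrow> 'c::{banach,second_countable_topology}"
  assumes "g \<in> borel_measurable M" "\<And>n. s n \<in> borel_measurable M"
    and "\<And>z. z \<in> space M \<Longrightarrow> (\<lambda>n. s n z) \<longlonglongrightarrow> g z"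
    and "\<And>n z. z \<in> space M \<Longrightarrow> norm (s n z) \<le> B"
  shows "(\<lambda>n. integral\<^sup>L (\<mu> x) (s n)) \<longlonglongrightarrow> integral\<^sup>L (\<mu> x) g"
  by (rule integral_dominated_convergence[where w = "\<lambda>_. B"])
    (use assms in \<open>auto intro: integrable_mu_bounded[where B = "norm B"]\<close>)

lemma has_spectral_integral_indicator:
  assumes S: "S \<in> sets M"
  shows "has_spectral_integral M E (indicator S) (E S)"
  unfolding has_spectral_integral_def
proof (intro conjI allI clinear_E S)
  fix x
  interpret finite_measure "\<mu> x" by (rule finite_measure_mu)
  have "integrable (\<mu> x) (\<lambda>z. complex_of_real (indicator S z))"
    using S by (intro integrable_of_real integrable_real_indicator) (simp_all add: emeasure_mu)
  then show "integrable (\<mu> x) (indicator S :: 'b \<Rightarrow> complex)"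
    by (simp add: of_real_indicator)
  have "integral\<^sup>L (\<mu> x) (\<lambda>z. complex_of_real (indicator S z)) = of_real (measure (\<mu> x) S)"
    using S sets.sets_into_space[OF S] by (simp add: Int_absorb2)
  then show "cinner x (E S x) = integral\<^sup>L (\<mu> x) (indicator S)"
    using S by (simp add: of_real_indicator measure_mu cinner_E)
qed

section \<open>Spectral integrals of simple functions\<close>

text \<open>The elementary spectral integral over the level sets of \<open>s\<close>, kept as a
  plain map on vectors; boundedness is established only for the limit operator.\<close>

definition simple_op :: "('b \<Rightarrow> complex) \<Rightarrow> 'a \<Rightarrow> 'a" where
  "simple_op s x = (\<Sum>c\<in>s ` space M. c *\<^sub>C E (s -` {c} \<inter> space M) x)"

lemma simple_op_add:
  "simple_op s (x + y) = simple_op s x + simple_op s y"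
  by (simp add: simple_op_def blinfun.add_right scaleC_add_right sum.distrib)

lemma simple_op_scaleC:
  assumes "simple_function M s"
  shows "simple_op s (a *\<^sub>C x) = a *\<^sub>C simple_op s x"
  using assms by (auto simp: simple_op_def scaleC_sum_right E_scaleC simple_functionD
      scaleC_scaleC mult.commute intro!: sum.cong)

lemma simple_function_eq_sum_indicator:
  fixes s :: "'b \<Rightarrow> complex"
  assumes "simple_function M s" and "z \<in> space M"
  shows "s z = (\<Sum>c\<in>s ` space M. c * indicator (s -` {c} \<inter> space M) z)"
proof -
  have "(\<Sum>c\<in>s ` space M. c * indicator (s -` {c} \<inter> space M) z) =
      (\<Sum>c\<in>s ` space M. if c = s z then c else 0)"
    using assms(2) by (intro sum.cong) (auto split: split_indicator)
  then show ?thesis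
    using assms by (simp add: simple_functionD)
qed

text \<open>Both sides expand over pairs of level sets. Multiplicativity of \<open>E\<close> turns
  each cross term into the \<open>\<mu> x\<close>-measure of an intersection. Since the same
  \<open>x\<close> stands in both arguments, positive measures suffice.\<close>

lemma cinner_simple_op_simple_op:
  assumes s: "simple_function M s" and t: "simple_function M t"
  shows "cinner (simple_op s x) (simple_op t x) = (\<integral>z. cnj (s z) * t z \<partial>\<mu> x)"
proof -
  let ?S = "\<lambda>c. s -` {c} \<inter> space M" and ?T = "\<lambda>d. t -` {d} \<inter> space M"
  have ind: "integrable (\<mu> x) (indicator S :: 'b \<Rightarrow> complex)"
    "integral\<^sup>L (\<mu> x) (indicator S) = cinner x (E S x)" if "S \<in> sets M" for S
    using has_spectral_integral_indicator[OF that] by (simp_all add: has_spectral_integral_def)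
  have ST: "?S c \<inter> ?T d \<in> sets M" for c d
    using s t by (auto simp: simple_functionD)
  have "(\<integral>z. cnj (s z) * t z \<partial>\<mu> x) =
    (\<integral>z. (\<Sum>c\<in>s ` space M. \<Sum>d\<in>t ` space M. cnj c * d * indicator (?S c \<inter> ?T d) z) \<partial>\<mu> x)"
  proof (rule Bochner_Integration.integral_cong[OF refl])
    fix z assume "z \<in> space (\<mu> x)"
    then have z: "z \<in> space M" by simp
    have "cnj (indicator A z) = indicator A z" for A
      by (simp add: indicator_def)
    then show "cnj (s z) * t z =
        (\<Sum>c\<in>s ` space M. \<Sum>d\<in>t ` space M. cnj c * d * indicator (?S c \<inter> ?T d) z)"
      unfolding arg_cong2[OF arg_cong[OF simple_function_eq_sum_indicator[OF s z], of cnj]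
          simple_function_eq_sum_indicator[OF t z], of times] cnj_sum sum_product
      by (intro sum.cong refl) (simp add: indicator_inter_arith mult_ac)
  qed
  also have "\<dots> = (\<Sum>c\<in>s ` space M. \<Sum>d\<in>t ` space M. cnj c * d * cinner x (E (?S c \<inter> ?T d) x))"
    using ind ST by (simp add: Bochner_Integration.integral_sum)
  also have "\<dots> = cinner (simple_op s x) (simple_op t x)"
    unfolding simple_op_def
    by (subst cinner_sum_left, intro sum.cong refl, subst cinner_sum_right, intro sum.cong refl)
      (use s t in \<open>simp add: cinner_scaleC_left cinner_scaleC_right cinner_E_E simple_functionD\<close>)
  finally show ?thesis ..
qed

lemma cinner_simple_op:
  assumes s: "simple_function M s"
  shows "cinner x (simple_op s x) = integral\<^sup>L (\<mu> x) s"
proof -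
  have "simple_op (\<lambda>_. 1) x = x"
  proof (cases "space M = {}")
    case True
    \<comment> \<open>On an empty space \<open>E\<close> takes the same value at \<open>{}\<close>
      and at the whole space, so the Hilbert space is zero.\<close>
    then have "id_blinfun = (0 :: 'a \<Rightarrow>\<^sub>L 'a)"
      using E_empty E_space by simp
    from arg_cong[OF this, of "\<lambda>T. T x"] have "x = 0" by simp
    then show ?thesis by (simp add: simple_op_def True)
  next
    case False
    then have "(\<lambda>_. 1) ` space M = {1::complex}" by auto
    then show ?thesis by (simp add: simple_op_def E_space)
  qed
  then show ?thesis
    using cinner_simple_op_simple_op[of "\<lambda>_. 1" s x] s by simp
qed

lemma integrable_mu_simple_function:
  fixes s :: "'b \<Rightarrow> complex"
  assumes "simple_function M s"
  shows "integrable (\<mu> x) s"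
proof (rule integrable_mu_bounded)
  show "s \<in> borel_measurable M"
    using assms by (rule borel_measurable_simple_function)
  show "norm (s z) \<le> Max (norm ` s ` space M)" if "z \<in> space M" for z
    using that assms by (intro Max_ge) (auto simp: simple_functionD)
qed

text \<open>The squared norm is expanded into four inner products, each of them an integral by
  \<open>cinner_simple_op_simple_op\<close>. This avoids a common refinement of the level sets of
  \<open>s\<close> and \<open>t\<close>.\<close>

lemma norm_simple_op_diff:
  assumes s: "simple_function M s" and t: "simple_function M t"
  shows "(norm (simple_op s x - simple_op t x))\<^sup>2 = (\<integral>z. (cmod (s z - t z))\<^sup>2 \<partial>\<mu> x)"
proof -
  have int: "integrable (\<mu> x) (\<lambda>z. cnj (u z) * v z)"
    if "simple_function M u" "simple_function M v" for u v
    by (rule integrable_mu_simple_function[OF simple_function_compose2[OF that]])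
  have "complex_of_real ((norm (simple_op s x - simple_op t x))\<^sup>2) =
      (\<integral>z. cnj (s z) * s z - cnj (s z) * t z - (cnj (t z) * s z - cnj (t z) * t z) \<partial>\<mu> x)"
    unfolding cinner_self[symmetric] cinner_diff_left cinner_diff_right
    by (simp add: cinner_simple_op_simple_op s t int[OF s s] int[OF s t] int[OF t s] int[OF t t])
  also have "\<dots> = (\<integral>z. complex_of_real ((cmod (s z - t z))\<^sup>2) \<partial>\<mu> x)"
    by (intro Bochner_Integration.integral_cong refl)
      (simp only: complex_norm_square complex_cnj_diff ring_distribs mult.commute)
  also have "\<dots> = complex_of_real (\<integral>z. (cmod (s z - t z))\<^sup>2 \<partial>\<mu> x)"
    by (rule integral_complex_of_real)
  finally show ?thesis
    by (simp only: of_real_eq_iff)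
qed

lemma norm_simple_op:
  assumes s: "simple_function M s"
  shows "(norm (simple_op s x))\<^sup>2 = (\<integral>z. (cmod (s z))\<^sup>2 \<partial>\<mu> x)"
proof -
  have "simple_op (\<lambda>_. 0) x = 0"
    by (auto simp: simple_op_def scaleC_zero_left intro!: sum.neutral)
  then show ?thesis
    using norm_simple_op_diff[OF s simple_function_const, of x 0] by simp
qed

section \<open>Spectral integrals of bounded functions\<close>

text \<open>The norm identity makes the images of simple approximants Cauchy at every vector. It is
  part of the conclusion because strong convergence of functional calculi is later read off from
  it.\<close>

lemma spectral_integral_exists:
  assumes g: "g \<in> borel_measurable M" and B: "\<And>z. z \<in> space M \<Longrightarrow> cmod (g z) \<le> B"
  obtains T where "has_spectral_integral M E g T"
    and "\<And>x. (norm (blinfun_apply T x))\<^sup>2 = (\<integral>z. (cmod (g z))\<^sup>2 \<partial>\<mu> x)"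
proof -
  note [measurable] = g
  obtain s where s: "\<And>n. simple_function M (s n)"
    and lim: "\<And>z. z \<in> space M \<Longrightarrow> (\<lambda>n. s n z) \<longlonglongrightarrow> g z"
    and bd: "\<And>n z. z \<in> space M \<Longrightarrow> cmod (s n z) \<le> 2 * cmod (g z)"
    using borel_measurable_implies_sequence_metric[OF g, of 0] unfolding dist_norm diff_0_right
    by metis
  have s_meas [measurable]: "s n \<in> borel_measurable M" for n
    using s by (rule borel_measurable_simple_function)
  \<comment> \<open>The approximants are bounded by \<open>2 * B\<close>, so \<open>4 * B\<close>
    bounds at once \<open>s n\<close>, its distance to \<open>g\<close> and the distance between two
    approximants.\<close>
  define C where "C = 4 * B"
  have sB: "cmod (s n z) \<le> 2 * B" and sC: "cmod (s n z) \<le> C" if "z \<in> space M" for n z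
    using bd[OF that, of n] B[OF that] norm_ge_zero[of "g z"] unfolding C_def by linarith+
  have "Cauchy (\<lambda>n. simple_op (s n) x)" for x
  proof (rule metric_CauchyI)
    fix e :: real assume e: "0 < e"
    let ?I = "\<lambda>n. \<integral>z. (cmod (s n z - g z))\<^sup>2 \<partial>\<mu> x"
    have diff_bd: "cmod (s n z - g z) \<le> C" if "z \<in> space M" for n z
      using norm_triangle_ineq4[of "s n z" "g z"] sB[OF that, of n] B[OF that]
        norm_ge_zero[of "g z"] unfolding C_def by linarith
    have int: "integrable (\<mu> x) (\<lambda>z. (cmod (s n z - g z))\<^sup>2)" for n
      by (rule integrable_mu_bounded[where B = "C\<^sup>2"]) (use diff_bd in \<open>auto intro: power_mono\<close>)
    have "?I \<longlonglongrightarrow> (\<integral>z. 0 \<partial>\<mu> x)"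
    proof (rule tendsto_integral_mu_bounded[where B = "C\<^sup>2"])
      fix z assume z: "z \<in> space M"
      have "(\<lambda>n. (cmod (s n z - g z))\<^sup>2) \<longlonglongrightarrow> (cmod (g z - g z))\<^sup>2"
        by (intro tendsto_intros lim z)
      then show "(\<lambda>n. (cmod (s n z - g z))\<^sup>2) \<longlonglongrightarrow> 0" by simp
    qed (use diff_bd in \<open>auto intro: power_mono\<close>)
    \<comment> \<open>The threshold fits the estimate
      \<open>(a + b)\<^sup>2 \<le> 2 * a\<^sup>2 + 2 * b\<^sup>2\<close> below: twice two such
      integrals stay under \<open>e\<^sup>2\<close>.\<close>
    then have "eventually (\<lambda>n. ?I n < e\<^sup>2 / 4) sequentially"
      using e by (intro order_tendstoD) auto
    then obtain N where N: "\<And>n. n \<ge> N \<Longrightarrow> ?I n < e\<^sup>2 / 4"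
      by (auto simp: eventually_sequentially)
    show "\<exists>N. \<forall>m\<ge>N. \<forall>n\<ge>N. dist (simple_op (s m) x) (simple_op (s n) x) < e"
    proof (intro exI allI impI)
      fix m n assume "N \<le> m" "N \<le> n"
      have "(norm (simple_op (s m) x - simple_op (s n) x))\<^sup>2 = (\<integral>z. (cmod (s m z - s n z))\<^sup>2 \<partial>\<mu> x)"
        using s by (rule norm_simple_op_diff) (rule s)
      also have "\<dots> \<le> (\<integral>z. 2 * (cmod (s m z - g z))\<^sup>2 + 2 * (cmod (s n z - g z))\<^sup>2 \<partial>\<mu> x)"
      proof (rule integral_mono)
        show "integrable (\<mu> x) (\<lambda>z. (cmod (s m z - s n z))\<^sup>2)"
        proof (rule integrable_mu_bounded[where B = "C\<^sup>2"])
          fix z assume z: "z \<in> space M"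
          have "cmod (s m z - s n z) \<le> C"
            using norm_triangle_ineq4[of "s m z" "s n z"] sB[OF z, of m] sB[OF z, of n]
            unfolding C_def by linarith
          then show "norm ((cmod (s m z - s n z))\<^sup>2) \<le> C\<^sup>2"
            by (simp add: power_mono)
        qed simp
        show "integrable (\<mu> x) (\<lambda>z. 2 * (cmod (s m z - g z))\<^sup>2 + 2 * (cmod (s n z - g z))\<^sup>2)"
          using int by simp
        fix z
        let ?a = "cmod (s m z - g z)" and ?b = "cmod (s n z - g z)"
        have "cmod (s m z - s n z) \<le> ?a + ?b"
          using norm_triangle_ineq4[of "s m z - g z" "s n z - g z"] by simp
        then have "(cmod (s m z - s n z))\<^sup>2 \<le> (?a + ?b)\<^sup>2"
          by (simp add: power_mono)
        also have "\<dots> \<le> 2 * ?a\<^sup>2 + 2 * ?b\<^sup>2"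
          using zero_le_power2[of "?a - ?b"] by (simp add: power2_eq_square algebra_simps)
        finally show "(cmod (s m z - s n z))\<^sup>2 \<le> 2 * ?a\<^sup>2 + 2 * ?b\<^sup>2" .
      qed
      also have "\<dots> = 2 * ?I m + 2 * ?I n"
        using int by simp
      also have "\<dots> < e\<^sup>2"
        using N[OF \<open>N \<le> m\<close>] N[OF \<open>N \<le> n\<close>] by simp
      finally show "dist (simple_op (s m) x) (simple_op (s n) x) < e"
        unfolding dist_norm using e by (rule power_less_imp_less_base[OF _ less_imp_le])
    qed
  qed
  then have "\<forall>x. \<exists>y. (\<lambda>n. simple_op (s n) x) \<longlonglongrightarrow> y"
    by (simp add: Cauchy_convergent_iff convergent_def)
  then obtain L where L: "\<And>x. (\<lambda>n. simple_op (s n) x) \<longlonglongrightarrow> L x"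
    by metis
  have norm_L: "(norm (L x))\<^sup>2 = (\<integral>z. (cmod (g z))\<^sup>2 \<partial>\<mu> x)" for x
  proof (rule LIMSEQ_unique)
    show "(\<lambda>n. (norm (simple_op (s n) x))\<^sup>2) \<longlonglongrightarrow> (norm (L x))\<^sup>2"
      by (intro tendsto_intros L)
    show "(\<lambda>n. (norm (simple_op (s n) x))\<^sup>2) \<longlonglongrightarrow> (\<integral>z. (cmod (g z))\<^sup>2 \<partial>\<mu> x)"
      unfolding norm_simple_op[OF s]
      by (rule tendsto_integral_mu_bounded[where B = "C\<^sup>2"])
        (use sC in \<open>auto intro!: power_mono tendsto_power tendsto_norm lim\<close>)
  qed
  have L_scaleC: "L (c *\<^sub>C x) = c *\<^sub>C L x" for c x
    using L[of "c *\<^sub>C x"] tendsto_scaleC[OF L[of x], of c]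
    unfolding simple_op_scaleC[OF s] by (rule LIMSEQ_unique)
  \<comment> \<open>The absolute value guards against a negative \<open>B\<close> on an empty space.
    The bound itself comes from the norm identity, as \<open>\<mu> x\<close> has total mass
    \<open>(norm x)\<^sup>2\<close>.\<close>
  have "bounded_linear L"
  proof (rule bounded_linear_intro[where K = "\<bar>B\<bar>"])
    fix x y
    show "L (x + y) = L x + L y"
      using L[of "x + y"] tendsto_add[OF L[of x] L[of y]]
      unfolding simple_op_add by (rule LIMSEQ_unique)
    show "L (r *\<^sub>R x) = r *\<^sub>R L x" for r
      by (simp add: scaleR_scaleC L_scaleC)
    interpret finite_measure "\<mu> x" by (rule finite_measure_mu)
    have "(norm (L x))\<^sup>2 \<le> (\<integral>z. B\<^sup>2 \<partial>\<mu> x)"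
      unfolding norm_L
    proof (rule integral_mono)
      show "integrable (\<mu> x) (\<lambda>z. (cmod (g z))\<^sup>2)"
        by (rule integrable_mu_bounded[where B = "B\<^sup>2"]) (use B in \<open>auto intro: power_mono\<close>)
    qed (use B in \<open>auto intro: power_mono\<close>)
    also have "\<dots> = (norm x * \<bar>B\<bar>)\<^sup>2"
      by (simp add: measure_mu E_space power_mult_distrib)
    finally show "norm (L x) \<le> norm x * \<bar>B\<bar>"
      by (rule power2_le_imp_le) simp
  qed
  then have apply_L: "blinfun_apply (Blinfun L) = L"
    by (rule bounded_linear_Blinfun_apply)
  have "cinner x (L x) = integral\<^sup>L (\<mu> x) g" for x
  proof (rule LIMSEQ_unique)
    show "(\<lambda>n. cinner x (simple_op (s n) x)) \<longlonglongrightarrow> cinner x (L x)"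
      by (intro tendsto_cinner_right L)
    show "(\<lambda>n. cinner x (simple_op (s n) x)) \<longlonglongrightarrow> integral\<^sup>L (\<mu> x) g"
      unfolding cinner_simple_op[OF s]
      by (rule tendsto_integral_mu_bounded[where B = C]) (use sC lim in auto)
  qed
  then have "has_spectral_integral M E g (Blinfun L)"
    unfolding has_spectral_integral_def clinear_op_def apply_L
    using L_scaleC integrable_mu_bounded[OF g B] by auto
  then show thesis
    by (rule that) (simp add: apply_L norm_L)
qed

lemma has_spectral_integral_bounded:
  assumes "g \<in> borel_measurable M" and "\<And>z. z \<in> space M \<Longrightarrow> cmod (g z) \<le> B"
  shows "has_spectral_integral M E g (spectral_integral M E g)"
  using spectral_integral_exists[OF assms] by (metis spectral_integral_eq)

text \<open>By uniqueness, the identity known for the constructed operator holds for every operator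
  that represents the integral.\<close>

lemma norm_has_spectral_integral:
  assumes "g \<in> borel_measurable M" and "\<And>z. z \<in> space M \<Longrightarrow> cmod (g z) \<le> B"
    and T: "has_spectral_integral M E g T"
  shows "(norm (blinfun_apply T x))\<^sup>2 = (\<integral>z. (cmod (g z))\<^sup>2 \<partial>\<mu> x)"
proof -
  obtain T' where "has_spectral_integral M E g T'"
    and "\<And>x. (norm (blinfun_apply T' x))\<^sup>2 = (\<integral>z. (cmod (g z))\<^sup>2 \<partial>\<mu> x)"
    using spectral_integral_exists[OF assms(1,2)] by blast
  with T show ?thesis
    by (metis has_spectral_integral_unique)
qed

text \<open>\<open>E S\<close> is the integral of the indicator, so the squared norm of the error at
  \<open>x\<close> is the integral of a bounded function that tends to 0 pointwise.\<close>

lemma tendsto_spectral_integral_indicator: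
  assumes g: "\<And>n. g n \<in> borel_measurable M" and B: "\<And>n z. z \<in> space M \<Longrightarrow> cmod (g n z) \<le> B"
    and S: "S \<in> sets M"
    and lim: "\<And>z. z \<in> space M \<Longrightarrow> (\<lambda>n. g n z) \<longlonglongrightarrow> indicator S z"
  shows "(\<lambda>n. blinfun_apply (spectral_integral M E (g n)) x) \<longlonglongrightarrow> E S x"
proof -
  note [measurable] = g S
  let ?D = "\<lambda>n. spectral_integral M E (g n) - E S"
  let ?d = "\<lambda>n z. g n z - indicator S z"
  have bd: "cmod (?d n z) \<le> B + 1" if "z \<in> space M" for n z
    using norm_triangle_ineq4[of "g n z" "indicator S z"] B[OF that, of n]
    by (auto simp: indicator_def split: if_splits)
  have "(norm (blinfun_apply (?D n) x))\<^sup>2 = (\<integral>z. (cmod (?d n z))\<^sup>2 \<partial>\<mu> x)" for n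
    by (rule norm_has_spectral_integral[where B = "B + 1"])
      (auto intro!: bd has_spectral_integral_diff has_spectral_integral_bounded[OF g B]
        has_spectral_integral_indicator S)
  moreover have "(\<lambda>n. \<integral>z. (cmod (?d n z))\<^sup>2 \<partial>\<mu> x) \<longlonglongrightarrow> (\<integral>z. 0 \<partial>\<mu> x)"
  proof (rule tendsto_integral_mu_bounded[where B = "(B + 1)\<^sup>2"])
    fix z assume z: "z \<in> space M"
    have "(\<lambda>n. (cmod (?d n z))\<^sup>2) \<longlonglongrightarrow> (cmod (indicator S z - indicator S z))\<^sup>2"
      by (intro tendsto_intros lim z)
    then show "(\<lambda>n. (cmod (?d n z))\<^sup>2) \<longlonglongrightarrow> 0" by simp
  qed (use bd in \<open>auto intro: power_mono\<close>)
  ultimately have "(\<lambda>n. (norm (blinfun_apply (?D n) x))\<^sup>2) \<longlonglongrightarrow> 0"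
    by simp
  then have "(\<lambda>n. norm (blinfun_apply (?D n) x)) \<longlonglongrightarrow> 0"
    by (auto dest: tendsto_real_sqrt)
  then have "(\<lambda>n. blinfun_apply (spectral_integral M E (g n)) x - E S x) \<longlonglongrightarrow> 0"
    by (simp add: blinfun.diff_left tendsto_norm_zero_iff)
  then show ?thesis
    by (rule LIM_zero_cancel)
qed

section \<open>Commutation with spectral projections\<close>

text \<open>Applying \<open>E S\<close> to the vector restricts its scalar measure to
  \<open>S\<close>, because \<open>E T\<close> after \<open>E S\<close> is
  \<open>E (T \<inter> S)\<close>.\<close>

lemma scalar_spectral_measure_E:
  assumes S: "S \<in> sets M"
  shows "\<mu> (E S x) = density (\<mu> x) (\<lambda>z. ennreal (indicator S z))"
proof (rule measure_eqI)
  fix T assume "T \<in> sets (\<mu> (E S x))"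
  then have T: "T \<in> sets M" by simp
  have "emeasure (density (\<mu> x) (indicator S)) T = emeasure (\<mu> x) (S \<inter> T)"
    using S T by (simp add: emeasure_density flip: indicator_inter_arith)
  then show "emeasure (\<mu> (E S x)) T = emeasure (density (\<mu> x) (\<lambda>z. ennreal (indicator S z))) T"
    using S T by (simp add: emeasure_mu E_E Int_commute ennreal_indicator)
qed simp

lemma integral_scalar_spectral_measure_E:
  fixes g :: "'b \<Rightarrow> complex"
  assumes S: "S \<in> sets M" and g: "integrable (\<mu> x) g"
  shows "integral\<^sup>L (\<mu> (E S x)) g = (\<integral>z. indicator S z *\<^sub>R g z \<partial>\<mu> x)"
  unfolding scalar_spectral_measure_E[OF S]
  using S g by (intro integral_density) auto

text \<open>The block diagonal part of \<open>T\<close> with respect to \<open>E S\<close> has the same quadratic form as \<open>T\<close>,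
  because the scalar measures of \<open>E S x\<close> and of its complementary part add up to that of \<open>x\<close>.\<close>

lemma has_spectral_integral_commute:
  assumes T: "has_spectral_integral M E g T" and S: "S \<in> sets M"
  shows "T o\<^sub>L E S = E S o\<^sub>L T"
proof -
  let ?S' = "space M - S"
  have S': "?S' \<in> sets M" using S by auto
  have int: "integrable (\<mu> x) g" and eq: "cinner x (T x) = integral\<^sup>L (\<mu> x) g" for x
    using T by (auto simp: has_spectral_integral_def)
  let ?D = "(E S o\<^sub>L T o\<^sub>L E S) + (E ?S' o\<^sub>L T o\<^sub>L E ?S')"
  have "cinner x (?D x) = integral\<^sup>L (\<mu> x) g" for x
  proof -
    \<comment> \<open>Self-adjointness moves the outer projection of each block to the left
      argument, leaving the quadratic form of \<open>T\<close> at \<open>E S x\<close> and at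
      \<open>E ?S' x\<close>.\<close>
    have "cinner x (?D x) = integral\<^sup>L (\<mu> (E S x)) g + integral\<^sup>L (\<mu> (E ?S' x)) g"
      by (simp add: blinfun.add_left cinner_add_right eq[symmetric] cinner_E_left S S')
    also have "\<dots> = (\<integral>z. indicator S z *\<^sub>R g z + indicator ?S' z *\<^sub>R g z \<partial>\<mu> x)"
      unfolding integral_scalar_spectral_measure_E[OF S int] integral_scalar_spectral_measure_E[OF S' int]
      using S S' int by (intro Bochner_Integration.integral_add[symmetric] integrable_mult_indicator) auto
    also have "\<dots> = integral\<^sup>L (\<mu> x) g"
      by (intro Bochner_Integration.integral_cong) (auto simp: indicator_def)
    finally show ?thesis .
  qed
  then have "has_spectral_integral M E g ?D"
    using T int S S' unfolding has_spectral_integral_def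
    by (auto intro!: clinear_op_add clinear_op_compose clinear_E)
  with T have D: "T = ?D"
    by (rule has_spectral_integral_unique)
  have disj: "S \<inter> ?S' = {}" "?S' \<inter> S = {}" by auto
  \<comment> \<open>In the block form of \<open>T\<close>, multiplication by \<open>E S\<close> on
    either side kills the complementary block and leaves the same compression.\<close>
  have "E S (T x) = E S (T (E S x))" "T (E S x) = E S (T (E S x))" for x
    by (subst (1) D; simp add: blinfun.add_left blinfun.add_right E_E S S' disj E_empty)+
  then show ?thesis
    by (intro blinfun_eqI) simp
qed

end

section \<open>Pointwise convergence and the strong operator topology\<close>

text \<open>The strong operator topology is pulled back along \<open>blinfun_apply\<close> from the
  product topology on functions, where convergence is pointwise.\<close>

lemma limitin_strong_operator_topologyI:
  fixes T :: "nat \<Rightarrow> 'a::real_normed_vector \<Rightarrow>\<^sub>L 'b::real_normed_vector"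
  assumes "\<And>x. (\<lambda>n. blinfun_apply (T n) x) \<longlonglongrightarrow> blinfun_apply L x"
  shows "limitin strong_operator_topology T L sequentially"
  unfolding limitin_def
proof (intro conjI allI impI)
  have lim: "(\<lambda>n. blinfun_apply (T n)) \<longlonglongrightarrow> blinfun_apply L"
    unfolding limitin_canonical_iff[symmetric] euclidean_product_topology[symmetric]
      limitin_componentwise using assms by simp
  fix W assume "openin strong_operator_topology W \<and> L \<in> W"
  then obtain V where "open V" "W = blinfun_apply -` V" "L \<in> W"
    by (auto simp: strong_operator_topology_def openin_pullback_topology)
  then show "eventually (\<lambda>n. T n \<in> W) sequentially"
    using topological_tendstoD[OF lim, of V] by auto
qed (simp add: strong_operator_topology_topspace)

section \<open>Continuity of the iterates and measurability of the fixed spectrum\<close>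

lemma comp_upto_continuous_on:
  assumes "\<And>k. k \<in> {1..K} \<Longrightarrow> continuous_on U (p k)"
    and "\<And>z j. z \<in> V \<Longrightarrow> j < K \<Longrightarrow> comp_upto p j z \<in> U" and "j \<le> K"
  shows "continuous_on V (comp_upto p j)"
  using assms(3)
proof (induction j)
  case 0
  then show ?case by (simp add: id_def)
next
  case (Suc j)
  then show ?case
    using assms(1)[of "Suc j"] assms(2)[of _ j] unfolding comp_upto.simps
    by (intro continuous_on_compose) (auto intro: continuous_on_subset)
qed

lemma iterate_continuous_on:
  assumes cont: "\<And>k. k \<in> {1..K} \<Longrightarrow> continuous_on U (p k)"
    and "iterate_defined_on U p K m V"
  shows "continuous_on V (comp_upto p K ^^ m)"
  using assms(2)
proof (induction m)
  case 0
  then show ?case by (simp add: id_def)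
next
  case (Suc m)
  let ?f = "comp_upto p K"
  have "continuous_on V (?f ^^ m)"
    using Suc by (auto simp: iterate_defined_on_def)
  \<comment> \<open>The instance \<open>i = m\<close> of definedness for \<open>Suc m\<close> says
    that the chain of the \<open>p k\<close> stays in \<open>U\<close> when started on the image of
    \<open>V\<close> under the \<open>m\<close>-th iterate.\<close>
  moreover have "continuous_on ((?f ^^ m) ` V) ?f"
    using Suc.prems by (intro comp_upto_continuous_on[OF cont]) (auto simp: iterate_defined_on_def)
  ultimately show ?case
    unfolding funpow.simps by (rule continuous_on_compose)
qed

text \<open>The set is cut out of the spectrum by finitely many equations between functions that are
  Borel on the spectrum.\<close>

lemma fixed_spectrum_measurable:
  assumes "\<And>k. k \<in> {1..K} \<Longrightarrow> continuous_on (spectrum A) (p k)"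
  shows "fixed_spectrum A p K \<in> sets (borel_spectrum A)"
proof -
  have [measurable]: "p k \<in> borel_measurable (borel_spectrum A)" if "k \<in> {1..K}" for k
    using assms that by (intro borel_measurable_continuous_on_restrict)
  have [measurable]: "(\<lambda>z. z) \<in> borel_measurable (borel_spectrum A)"
    by (intro borel_measurable_continuous_on_restrict continuous_intros)
  have "{z \<in> space (borel_spectrum A). cmod z = 1 \<and> (\<forall>k\<in>{1..K}. p k z = z)}
      \<in> sets (borel_spectrum A)"
    by measurable
  then show ?thesis
    by (simp add: fixed_spectrum_def space_restrict_space)
qed

lemma cmod_le_sup_norm_on: "z \<in> S \<Longrightarrow> ennreal (cmod (g z)) \<le> sup_norm_on S g"
  unfolding sup_norm_on_def by (rule SUP_upper)

theorem corollary2p4: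
  fixes A :: "'a::complex_hilbert_space \<Rightarrow>\<^sub>L 'a"
    and E :: "complex set \<Rightarrow> ('a \<Rightarrow>\<^sub>L 'a)"
    and U :: "complex set"
    and p :: "nat \<Rightarrow> complex \<Rightarrow> complex"
    and f :: "complex \<Rightarrow> complex"
    and K :: nat
  assumes "normal_op A"
    and "is_spectral_measure A E"
    and "open U" and "spectrum A \<subseteq> U"
    and "\<And>k. k \<in> {1..K} \<Longrightarrow> p k holomorphic_on U"
    and "\<And>k. k \<in> {1..K} \<Longrightarrow> sup_norm_on (spectrum A) (p k) \<le> 1"
    and "\<And>k. k \<in> {1..K} \<Longrightarrow> p k 1 = 1"
    and "f = comp_upto p K"
    and "\<And>m. \<exists>V. open V \<and> spectrum A \<subseteq> V \<and> iterate_defined_on U p K m V"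
    and "\<And>z. z \<in> fixed_spectrum A p K \<Longrightarrow> (\<lambda>m. (f ^^ m) z) \<longlonglongrightarrow> 1"
    and "\<And>z. z \<in> spectrum A - fixed_spectrum A p K \<Longrightarrow> (\<lambda>m. (f ^^ m) z) \<longlonglongrightarrow> 0"
    and "(SUP m\<in>{1..}. sup_norm_on (spectrum A) (f ^^ m)) \<le> 1"
  shows "limitin strong_operator_topology (\<lambda>m. borel_calculus A E (f ^^ m))
           (E (fixed_spectrum A p K)) sequentially
       \<and> orthogonal_projection (E (fixed_spectrum A p K))
       \<and> A o\<^sub>L E (fixed_spectrum A p K) = E (fixed_spectrum A p K) o\<^sub>L A"
proof -
  let ?M = "borel_spectrum A" and ?S = "fixed_spectrum A p K"
  interpret pvm ?M E
    using assms(2) by unfold_locales (simp add: is_spectral_measure_def)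
  have A: "has_spectral_integral ?M E (\<lambda>z. z) A"
    using assms(2) by (simp add: is_spectral_measure_def)
  have cont: "continuous_on U (p k)" if "k \<in> {1..K}" for k
    using assms(5)[OF that] by (rule holomorphic_on_imp_continuous_on)
  have S: "?S \<in> sets ?M"
    by (rule fixed_spectrum_measurable[OF continuous_on_subset[OF cont assms(4)]])
  have meas: "f ^^ m \<in> borel_measurable ?M" for m
  proof -
    obtain V where "spectrum A \<subseteq> V" "iterate_defined_on U p K m V"
      using assms(9) by blast
    then have "continuous_on (spectrum A) (f ^^ m)"
      unfolding assms(8) by (intro continuous_on_subset[OF iterate_continuous_on[OF cont]])
    then show ?thesis
      by (rule borel_measurable_continuous_on_restrict)
  qed
  \<comment> \<open>The assumed supremum starts at \<open>m = 1\<close> and says nothing about the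
    zeroth iterate, the identity. The sequence is therefore shifted by one until the limit has been
    taken.\<close>
  have bound: "cmod ((f ^^ Suc m) z) \<le> 1" if "z \<in> space ?M" for m z
  proof -
    have "ennreal (cmod ((f ^^ Suc m) z)) \<le> sup_norm_on (spectrum A) (f ^^ Suc m)"
      using that by (intro cmod_le_sup_norm_on) (simp add: space_restrict_space)
    also have "\<dots> \<le> (SUP m\<in>{1..}. sup_norm_on (spectrum A) (f ^^ m))"
      by (rule SUP_upper) simp
    also have "\<dots> \<le> 1" by fact
    finally show ?thesis by (simp only: ennreal_le_1)
  qed
  \<comment> \<open>The limits 1 on the fixed spectrum and 0 off it are together the indicator of
    that set.\<close>
  have "(\<lambda>m. (f ^^ Suc m) z) \<longlonglongrightarrow> indicator ?S z" if "z \<in> space ?M" for z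
  proof (rule LIMSEQ_Suc)
    show "(\<lambda>m. (f ^^ m) z) \<longlonglongrightarrow> indicator ?S z"
      using that assms(10,11)[of z] by (cases "z \<in> ?S") (simp_all add: space_restrict_space)
  qed
  then have "(\<lambda>m. borel_calculus A E (f ^^ Suc m) x) \<longlonglongrightarrow> E ?S x" for x
    unfolding borel_calculus_def
    by (intro tendsto_spectral_integral_indicator[where g = "\<lambda>m. f ^^ Suc m", OF meas bound S])
  then have "(\<lambda>m. borel_calculus A E (f ^^ m) x) \<longlonglongrightarrow> E ?S x" for x
    by (rule LIMSEQ_imp_Suc)
  then show ?thesis
    using orthogonal_projection_E[OF S] has_spectral_integral_commute[OF A S]
    by (intro conjI limitin_strong_operator_topologyI)
qed

end
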